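(* Let $n\ge 2$ be an integer and let $X$ be an $n$-Hausdorff homogeneous topological space. Then $$|X|\le 2^{2^{\cdot^{\cdot^{\cdot^{2^{c(X)\pi\chi(X)}}}}}},$$ where the power is taken $(n-1)$ many times; that is, $|X|\le E_{n-1}(c(X)\pi\chi(X))$, where $E_0(\kappa)=\kappa$ and $E_{k+1}(\kappa)=2^{E_k(\kappa)}$.
   Context: No separation axioms are assumed unless stated. The Hausdorff number $H(X)$ of a topological space $X$ is the least cardinal $\kappa$ (finite or infinite) such that for every $A\subseteq X$ with $|A|\ge\kappa$ there are open neighbourhoods $U_a$ of $a$, for $a\in A$, with $\bigcap_{a\in A}U_a=\emptyset$. $X$ is $n$-Hausdorff if $H(X)\le n$. $X$ is homogeneous if for all $x,y\in X$ there is a homeomorphism $h:X\to X$ with $h(x)=y$. $c(X)$ is the cellularity (supremum of cardinalities of families of pairwise disjoint nonempty open sets) and $\pi\chi(X)$ is the $\pi$-character (supremum over $x\in X$ of the least cardinality of a local $\pi$-base at $x$, i.e. a family of nonempty open sets such that each neighbourhood of $x$ contains a member of it). All cardinal functions are multiplied by $\omega$, hence are infinite. *)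

theory Defs
  imports "HOL-Analysis.Abstract_Topology"
begin

unbundle cardinal_syntax

section \<open>Least cardinals\<close>

text \<open>
  Cardinals are relations \<open>r\<close> with \<open>Card_order r\<close>, compared by \<open>\<le>o\<close>. A least cardinal is
  only determined up to \<open>=o\<close>, hence the choice operator. Every cardinal below some \<open>r :: 'b rel\<close>
  is isomorphic to a cardinal on \<open>'b\<close>, so as soon as the \<open>=o\<close>-invariant property \<open>P\<close> holds of
  some cardinal on \<open>'b\<close>, the minimum over the cardinals on \<open>'b\<close> is the minimum over all cardinals.
  In the uses below, \<open>'b = 'a set\<close> for spaces on \<open>'a\<close>, and the lemmas named \<open>_exists\<close> show that
  such a cardinal is always available.
\<close>

definition is_least_cardinal :: "('b rel \<Rightarrow> bool) \<Rightarrow> 'b rel \<Rightarrow> bool" where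
  "is_least_cardinal P r \<longleftrightarrow>
     Card_order r \<and> P r \<and> (\<forall>r'. Card_order r' \<and> P r' \<longrightarrow> r \<le>o r')"

definition least_cardinal :: "('b rel \<Rightarrow> bool) \<Rightarrow> 'b rel" where
  "least_cardinal P = (SOME r. is_least_cardinal P r)"

lemma is_least_cardinal_least_cardinal:
  assumes "Card_order r" "P r"
  shows "is_least_cardinal P (least_cardinal P)"
proof -
  let ?R = "{r. Card_order r \<and> P r}"
  have "?R \<noteq> {}" "\<forall>r\<in>?R. Well_order r"
    using assms by (auto simp: card_order_on_def)
  then obtain r0 where "r0 \<in> ?R" "\<forall>r'\<in>?R. r0 \<le>o r'"
    using exists_minim_Well_order[of ?R] by blast
  then have "is_least_cardinal P r0"
    by (auto simp: is_least_cardinal_def)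
  then show ?thesis
    unfolding least_cardinal_def by (rule someI)
qed


section \<open>Hausdorff number and homogeneity\<close>

text \<open>The intersection is taken in \<open>X\<close>, so that for \<open>A = {}\<close> it is \<open>topspace X\<close>.\<close>

definition hausdorff_bound :: "'a topology \<Rightarrow> 'b rel \<Rightarrow> bool" where
  "hausdorff_bound X \<kappa> \<longleftrightarrow>
     (\<forall>A. A \<subseteq> topspace X \<and> \<kappa> \<le>o |A| \<longrightarrow>
        (\<exists>U. (\<forall>a\<in>A. openin X (U a) \<and> a \<in> U a) \<and> topspace X \<inter> (\<Inter>a\<in>A. U a) = {}))"

definition hausdorff_number :: "'a topology \<Rightarrow> 'a set rel" where
  "hausdorff_number X = least_cardinal (hausdorff_bound X)"

definition n_hausdorff :: "nat \<Rightarrow> 'a topology \<Rightarrow> bool" where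
  "n_hausdorff n X \<longleftrightarrow> hausdorff_number X \<le>o |{..<n}|"

definition homogeneous_space :: "'a topology \<Rightarrow> bool" where
  "homogeneous_space X \<longleftrightarrow>
     (\<forall>x\<in>topspace X. \<forall>y\<in>topspace X. \<exists>h. homeomorphic_map X X h \<and> h x = y)"

lemma hausdorff_number_exists:
  fixes X :: "'a topology"
  shows "hausdorff_bound X |UNIV :: 'a set set|"
proof -
  have "\<not> |UNIV :: 'a set set| \<le>o |A|" for A :: "'a set"
  proof
    assume "|UNIV :: 'a set set| \<le>o |A|"
    also have "|A| \<le>o |UNIV :: 'a set|"
      by (rule card_of_mono1) simp
    also have "|UNIV :: 'a set| <o |UNIV :: 'a set set|"
      using card_of_Pow[of "UNIV :: 'a set"] by simp
    finally show False
      using ordLess_irreflexive by blast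
  qed
  then show ?thesis
    by (simp add: hausdorff_bound_def)
qed


section \<open>Cellularity and \<open>\<pi>\<close>-character\<close>

text \<open>
  A supremum of cardinals is the least cardinal above all of them. Multiplication by \<open>natLeq\<close> is
  multiplication by \<open>\<omega>\<close>; the product is infinite whenever \<open>X\<close> is nonempty.
\<close>

definition cellular_family :: "'a topology \<Rightarrow> 'a set set \<Rightarrow> bool" where
  "cellular_family X \<F> \<longleftrightarrow> (\<forall>U\<in>\<F>. openin X U \<and> U \<noteq> {}) \<and> pairwise disjnt \<F>"

definition cellularity :: "'a topology \<Rightarrow> (nat \<times> 'a set) rel" where
  "cellularity X =
     natLeq *c least_cardinal (\<lambda>\<kappa>. \<forall>\<F>. cellular_family X \<F> \<longrightarrow> |\<F>| \<le>o \<kappa>)"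

definition local_pi_base :: "'a topology \<Rightarrow> 'a \<Rightarrow> 'a set set \<Rightarrow> bool" where
  "local_pi_base X x \<B> \<longleftrightarrow>
     (\<forall>B\<in>\<B>. openin X B \<and> B \<noteq> {}) \<and>
     (\<forall>V. openin X V \<and> x \<in> V \<longrightarrow> (\<exists>B\<in>\<B>. B \<subseteq> V))"

definition pi_character_at :: "'a topology \<Rightarrow> 'a \<Rightarrow> 'a set rel" where
  "pi_character_at X x = least_cardinal (\<lambda>\<kappa>. \<exists>\<B>. local_pi_base X x \<B> \<and> \<kappa> =o |\<B>| )"

definition pi_character :: "'a topology \<Rightarrow> (nat \<times> 'a set) rel" where
  "pi_character X =
     natLeq *c least_cardinal (\<lambda>\<kappa>. \<forall>x\<in>topspace X. pi_character_at X x \<le>o \<kappa>)"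

lemma cellularity_exists:
  fixes X :: "'a topology"
  shows "\<forall>\<F>. cellular_family X \<F> \<longrightarrow> |\<F>| \<le>o |UNIV :: 'a set set|"
  by (simp add: card_of_mono1)

lemma pi_character_at_exists:
  "\<exists>\<B>. local_pi_base X x \<B> \<and> |{U. openin X U \<and> U \<noteq> {}}| =o |\<B>|"
proof (intro exI conjI)
  show "local_pi_base X x {U. openin X U \<and> U \<noteq> {}}"
    by (auto simp: local_pi_base_def)
qed (rule card_of_refl)

lemma pi_character_exists:
  fixes X :: "'a topology"
  shows "\<forall>x\<in>topspace X. pi_character_at X x \<le>o |UNIV :: 'a set set|"
proof
  fix x
  have "is_least_cardinal (\<lambda>\<kappa>. \<exists>\<B>. local_pi_base X x \<B> \<and> \<kappa> =o |\<B>| ) (pi_character_at X x)"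
    unfolding pi_character_at_def
    by (rule is_least_cardinal_least_cardinal)
      (rule card_of_Card_order, rule pi_character_at_exists)
  then obtain \<B> :: "'a set set" where "pi_character_at X x =o |\<B>|"
    by (auto simp: is_least_cardinal_def)
  then show "pi_character_at X x \<le>o |UNIV :: 'a set set|"
    using card_of_mono1[OF subset_UNIV] ordIso_ordLeq_trans by blast
qed


section \<open>Iterated exponentials\<close>

text \<open>
  The cardinals \<open>E\<^sub>0(\<kappa>) = \<kappa>\<close> and \<open>E\<^sub>k\<^sub>+\<^sub>1(\<kappa>) = 2 ^ E\<^sub>k(\<kappa>)\<close> live on types that grow with \<open>k\<close>, and for
  infinite \<open>\<kappa>\<close> no single type need carry all of them, so \<open>E\<^sub>k(\<kappa>)\<close> is not a function of a variable
  \<open>k\<close>. The relation \<open>\<mu> \<le> E\<^sub>k(\<kappa>)\<close> is: for a cardinal \<open>\<mu>\<close> one has \<open>\<mu> \<le> 2 ^ E\<^sub>k(\<kappa>)\<close> iff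
  \<open>\<mu> \<le> 2 ^ \<nu>\<close> for some cardinal \<open>\<nu> \<le> E\<^sub>k(\<kappa>)\<close>, and \<open>\<nu>\<close> can be found on the type of \<open>\<mu>\<close>
  (take the minimum of \<open>\<mu>\<close> and \<open>E\<^sub>k(\<kappa>)\<close>). The lemmas below establish this: whenever a cardinal \<open>\<epsilon>\<close>,
  on whatever type, is \<open>E\<^sub>k(\<kappa>)\<close>, then \<open>ordLeq_exp_tower \<mu> k \<kappa>\<close> is \<open>\<mu> \<le>o \<epsilon>\<close>.
\<close>

primrec ordLeq_exp_tower :: "'b rel \<Rightarrow> nat \<Rightarrow> 'c rel \<Rightarrow> bool" where
  "ordLeq_exp_tower \<mu> 0 \<kappa> \<longleftrightarrow> \<mu> \<le>o \<kappa>"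
| "ordLeq_exp_tower \<mu> (Suc k) \<kappa> \<longleftrightarrow>
     (\<exists>\<nu> :: 'b rel. Card_order \<nu> \<and> ordLeq_exp_tower \<nu> k \<kappa> \<and> \<mu> \<le>o ctwo ^c \<nu>)"

lemma ctwo_cexp_mono:
  assumes "\<nu> \<le>o \<epsilon>"
  shows "ctwo ^c \<nu> \<le>o ctwo ^c \<epsilon>"
proof (cases "Field \<nu> = {}")
  case True
  have "Func (Field \<epsilon>) (Field ctwo) \<noteq> {}"
    unfolding Func_is_emp by (simp add: ctwo_def Field_card_of)
  then show ?thesis
    using True by (simp add: cexp_def Func_empty card_of_singl_ordLeq)
next
  case False
  then show ?thesis
    using assms Card_order_ctwo by (intro cexp_mono2') auto
qed

lemma ordLeq_exp_tower_Suc_iff: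
  fixes \<mu> :: "'b rel" and \<epsilon> :: "'e rel"
  assumes E: "\<And>\<nu> :: 'b rel. Card_order \<nu> \<Longrightarrow> ordLeq_exp_tower \<nu> k \<kappa> \<longleftrightarrow> \<nu> \<le>o \<epsilon>"
    and \<epsilon>: "Card_order \<epsilon>" and \<mu>: "Card_order \<mu>"
  shows "ordLeq_exp_tower \<mu> (Suc k) \<kappa> \<longleftrightarrow> \<mu> \<le>o ctwo ^c \<epsilon>"
proof
  assume "ordLeq_exp_tower \<mu> (Suc k) \<kappa>"
  then obtain \<nu> :: "'b rel" where \<nu>: "Card_order \<nu>" "\<nu> \<le>o \<epsilon>" "\<mu> \<le>o ctwo ^c \<nu>"
    using E by auto
  have "ctwo ^c \<nu> \<le>o ctwo ^c \<epsilon>"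
    using \<nu>(2) by (rule ctwo_cexp_mono)
  with \<nu>(3) show "\<mu> \<le>o ctwo ^c \<epsilon>"
    by (rule ordLeq_transitive)
next
  assume le: "\<mu> \<le>o ctwo ^c \<epsilon>"
  have "\<mu> \<le>o \<epsilon> \<or> \<epsilon> \<le>o \<mu>"
    using \<mu> \<epsilon> by (intro ordLeq_total) (auto simp: card_order_on_def)
  then show "ordLeq_exp_tower \<mu> (Suc k) \<kappa>"
  proof
    assume "\<mu> \<le>o \<epsilon>"
    moreover have "\<mu> \<le>o ctwo ^c \<mu>"
      using ordLess_ctwo_cexp[OF \<mu>] by (rule ordLess_imp_ordLeq)
    ultimately show ?thesis
      using \<mu> E[of \<mu>] by auto
  next
    assume "\<epsilon> \<le>o \<mu>"
    then obtain \<nu> :: "'b rel" where iso: "\<epsilon> =o \<nu>"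
      by (auto simp: internalize_ordLeq[of \<epsilon> \<mu>])
    have \<nu>: "Card_order \<nu>"
      using \<epsilon> iso by (rule Card_order_ordIso2)
    have "ctwo ^c \<epsilon> =o ctwo ^c \<nu>"
      by (rule cexp_cong2[OF iso Card_order_ctwo \<epsilon>])
    with le have "\<mu> \<le>o ctwo ^c \<nu>"
      by (rule ordLeq_ordIso_trans)
    moreover have "\<nu> \<le>o \<epsilon>"
      by (rule ordIso_imp_ordLeq[OF ordIso_symmetric[OF iso]])
    ultimately show ?thesis
      using \<nu> E[of \<nu>] by auto
  qed
qed

lemma ordLeq_cong_right:
  assumes "r =o s"
  shows "\<mu> \<le>o r \<longleftrightarrow> \<mu> \<le>o s"
proof
  assume "\<mu> \<le>o r"
  then show "\<mu> \<le>o s"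
    using assms by (rule ordLeq_ordIso_trans)
next
  assume "\<mu> \<le>o s"
  then show "\<mu> \<le>o r"
    using ordIso_symmetric[OF assms] by (rule ordLeq_ordIso_trans)
qed

lemma ordLeq_exp_tower_iff:
  fixes \<mu> :: "'b rel" and \<kappa> :: "'c rel" and E :: "nat \<Rightarrow> 'e rel"
  assumes "\<And>k. k \<le> m \<Longrightarrow> Card_order (E k)"
    and "E 0 =o \<kappa>" and "\<And>k. k < m \<Longrightarrow> E (Suc k) =o ctwo ^c E k"
    and "Card_order \<mu>"
  shows "ordLeq_exp_tower \<mu> m \<kappa> \<longleftrightarrow> \<mu> \<le>o E m"
  using assms
proof (induction m arbitrary: \<mu>)
  case 0
  then show ?case
    using ordLeq_cong_right[of "E 0" \<kappa> \<mu>] by simp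
next
  case (Suc m)
  have "ordLeq_exp_tower \<mu> (Suc m) \<kappa> \<longleftrightarrow> \<mu> \<le>o ctwo ^c E m"
  proof (rule ordLeq_exp_tower_Suc_iff)
    fix \<nu> :: "'b rel"
    assume "Card_order \<nu>"
    then show "ordLeq_exp_tower \<nu> m \<kappa> \<longleftrightarrow> \<nu> \<le>o E m"
      using Suc.prems by (intro Suc.IH) simp_all
  qed (use Suc.prems in simp_all)
  also have "\<dots> \<longleftrightarrow> \<mu> \<le>o E (Suc m)"
    by (rule ordLeq_cong_right[OF ordIso_symmetric[OF Suc.prems(3)]]) simp
  finally show ?case .
qed

lemma ordLeq_exp_tower_2_iff:
  assumes "Card_order \<mu>" "Card_order \<kappa>"
  shows "ordLeq_exp_tower \<mu> 2 \<kappa> \<longleftrightarrow> \<mu> \<le>o ctwo ^c (ctwo ^c \<kappa>)"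
  unfolding numeral_2_eq_2
proof (rule ordLeq_exp_tower_Suc_iff)
  fix \<nu> :: "'a rel"
  assume "Card_order \<nu>"
  then show "ordLeq_exp_tower \<nu> (Suc 0) \<kappa> \<longleftrightarrow> \<nu> \<le>o ctwo ^c \<kappa>"
    using assms(2) by (intro ordLeq_exp_tower_Suc_iff) simp_all
qed (rule Card_order_cexp assms)+

end

(*
  Fix a point p with a local pi-base B of size at most the pi-character, and homeomorphisms h_x of X
  with h_x(p) = x. For an n-element set F the n-Hausdorff property gives neighbourhoods of the points
  of F with empty intersection; pulling them all back to p, some member f(F) of B satisfies
  (INT a:F. h_a(f(F))) = {}. If H is homogeneous for the colouring f, with colour b, then the open sets
  h_a(b), a in H, have empty n-wise intersections. A maximal subfamily with nonempty intersection
  is then finite, and the intersections of these maximal subfamilies are pairwise disjoint, so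
  |H| is at most the cellularity (times omega). The Erdos-Rado theorem, in the form "if all
  homogeneous sets have size at most k then |X| is at most E_{n-1}(k)", concludes.
*)
theory Submission
  imports Defs
begin

section \<open>Cardinality of sets of finite lists\<close>

lemma card_of_lists_le:
  fixes \<epsilon> :: "'b rel"
  assumes "Cinfinite \<epsilon>" "|L| \<le>o \<epsilon>"
  shows "|lists L| \<le>o \<epsilon>"
proof -
  have len: "|{xs. set xs \<subseteq> L \<and> length xs = n}| \<le>o \<epsilon>" for n
  proof (induction n)
    case 0
    have "{xs. set xs \<subseteq> L \<and> length xs = 0} = {[]}"
      by auto
    then show ?case
      using assms(1) card_of_singl_ordLeq[of "Field \<epsilon>" "[]"] card_of_Field_ordIso[of \<epsilon>]
      by (metis Cinfinite_Cnotzero Card_order_singl_ordLeq Cnotzero_imp_not_empty)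
  next
    case (Suc n)
    let ?S = "{xs. set xs \<subseteq> L \<and> length xs = n}"
    have "{xs. set xs \<subseteq> L \<and> length xs = Suc n} = (\<lambda>(a, xs). a # xs) ` (L \<times> ?S)"
      by (force simp: length_Suc_conv)
    then have "|{xs. set xs \<subseteq> L \<and> length xs = Suc n}| \<le>o |L \<times> ?S|"
      by (simp only: card_of_image)
    also have "|L \<times> ?S| \<le>o \<epsilon>"
      using assms Suc by (intro card_of_Times_ordLeq_infinite_Field) (auto simp: cinfinite_def)
    finally show ?case .
  qed
  have "lists L = (\<Union>n. {xs. set xs \<subseteq> L \<and> length xs = n})"
    by auto
  moreover have "|UNIV :: nat set| \<le>o \<epsilon>"
    using assms(1) natLeq_ordLeq_cinfinite card_of_nat ordIso_ordLeq_trans by blast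
  ultimately show ?thesis
    using UNION_Cinfinite_bound[of "UNIV :: nat set" \<epsilon> "\<lambda>n. {xs. set xs \<subseteq> L \<and> length xs = n}"]
      assms(1) len by simp
qed


section \<open>The partition theorem\<close>

text \<open>
  The branch of \<open>x\<close> in the Erdos--Rado tree: going up along the well-order \<open>r\<close>, a point \<open>y\<close> below \<open>x\<close>
  is taken if \<open>f\<close> cannot distinguish \<open>y\<close> from \<open>x\<close> over finite sets of points taken before.
\<close>

definition branch :: "'a rel \<Rightarrow> ('a set \<Rightarrow> 'k) \<Rightarrow> 'a set \<Rightarrow> 'a \<Rightarrow> 'a set" where
  "branch r f A x = {y. (y, x) \<in> r \<and> wfrec r (\<lambda>Q y. y \<in> A \<and> (y, x) \<in> r \<and>
     (\<forall>F. finite F \<and> F \<subseteq> {z. (z, y) \<in> r \<and> Q z} \<longrightarrow> f (insert y F) = f (insert x F))) y}"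

text \<open>The recursive body asks about \<open>Q\<close> only at points below \<open>y\<close>, so
  the cut made by \<open>wfrec\<close> changes nothing. All later arguments about branches rest on
  this fixed-point equation.\<close>

lemma mem_branch_iff:
  assumes "wf r"
  shows "y \<in> branch r f A x \<longleftrightarrow> y \<in> A \<and> (y, x) \<in> r \<and>
    (\<forall>F. finite F \<and> F \<subseteq> {z \<in> branch r f A x. (z, y) \<in> r} \<longrightarrow> f (insert y F) = f (insert x F))"
proof -
  define H where "H = (\<lambda>Q y. y \<in> A \<and> (y, x) \<in> r \<and>
     (\<forall>F. finite F \<and> F \<subseteq> {z. (z, y) \<in> r \<and> Q z} \<longrightarrow> f (insert y F) = f (insert x F)))"
  have "wfrec r H y \<longleftrightarrow> H (cut (wfrec r H) r y) y" for y
    by (simp add: wfrec[OF assms])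
  also have "H (cut (wfrec r H) r y) y \<longleftrightarrow> H (wfrec r H) y" for y
  proof -
    have "{z. (z, y) \<in> r \<and> cut (wfrec r H) r y z} = {z. (z, y) \<in> r \<and> wfrec r H z}"
      by (auto simp: cut_apply)
    then show ?thesis
      by (simp add: H_def)
  qed
  finally have eq: "wfrec r H y \<longleftrightarrow> H (wfrec r H) y" for y .
  have mem: "y \<in> branch r f A x \<longleftrightarrow> wfrec r H y" for y
    using eq[of y] by (auto simp: branch_def H_def)
  show ?thesis
    unfolding mem Collect_conj_eq using eq[of y] by (simp add: H_def Int_def conj_commute)
qed

text \<open>
  The code of \<open>x\<close> is the isomorphism type of its branch together with the colours \<open>f (insert x F)\<close>,
  transported along an injection \<open>e x\<close> into a fixed set.
\<close>

definition branch_code ::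
  "'a rel \<Rightarrow> ('a set \<Rightarrow> 'k) \<Rightarrow> 'a set \<Rightarrow> ('a \<Rightarrow> 'a \<Rightarrow> 'b) \<Rightarrow> 'a \<Rightarrow> ('b list \<times> bool \<times> 'k) set" where
  "branch_code r f A e x = (\<lambda>ys. (map (e x) ys, sorted_wrt (\<lambda>y z. (y, z) \<in> r) ys,
     f (insert x (set ys)))) ` lists (branch r f A x)"

text \<open>The triple contributed to the code by \<open>ys\<close> must also be contributed by some
  list of the other branch. Lists of length one and two transport labels and order, lists of any
  length transport colours.\<close>

lemma branch_code_transfer:
  assumes "branch_code r f A e x = branch_code r f A e x'" "set ys \<subseteq> branch r f A x"
  obtains ys' where "set ys' \<subseteq> branch r f A x'" "map (e x) ys = map (e x') ys'"
    "sorted_wrt (\<lambda>y z. (y, z) \<in> r) ys = sorted_wrt (\<lambda>y z. (y, z) \<in> r) ys'"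
    "f (insert x (set ys)) = f (insert x' (set ys'))"
proof -
  have "(map (e x) ys, sorted_wrt (\<lambda>y z. (y, z) \<in> r) ys, f (insert x (set ys)))
      \<in> branch_code r f A e x'"
    unfolding assms(1)[symmetric] using assms(2) by (auto simp: branch_code_def)
  then show ?thesis
    by (auto simp: branch_code_def intro!: that)
qed

text \<open>The transferred list has the same labels under \<open>e x'\<close> as the original list
  of \<open>F\<close>; injectivity makes the two lists equal, so both colours are taken over the
  same \<open>F\<close>.\<close>

lemma branch_code_transfer_eq:
  assumes code: "branch_code r f A e x = branch_code r f A e x'"
    and inj: "inj_on (e x') (branch r f A x')"
    and F: "finite F" "F \<subseteq> branch r f A x" "\<And>v. v \<in> F \<Longrightarrow> v \<in> branch r f A x' \<and> e x v = e x' v"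
  shows "f (insert x F) = f (insert x' F)"
proof -
  obtain ys where ys: "set ys = F"
    using F(1) finite_list by blast
  obtain ys' where ys': "set ys' \<subseteq> branch r f A x'" "map (e x) ys = map (e x') ys'"
    "f (insert x F) = f (insert x' (set ys'))"
    using branch_code_transfer[OF code, of ys] ys F(2) by metis
  have "map (e x') ys = map (e x') ys'"
    using ys'(2) F(3) ys by (metis map_eq_conv)
  moreover have "inj_on (e x') (set ys \<union> set ys')"
    using inj F(3) ys ys'(1) by (auto intro: inj_on_subset)
  ultimately have "ys = ys'"
    by (metis inj_on_map_eq_map)
  with ys' ys show ?thesis
    by simp
qed

text \<open>Let \<open>w'\<close> be the point of the second branch with the label of
  \<open>w\<close>. The branches coincide below \<open>w\<close> and \<open>w'\<close>, with equal
  colours. If \<open>w\<close> and \<open>w'\<close> differed, the smaller one would join the other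
  branch, and the coincidence of predecessors would put it below itself.\<close>

lemma branch_code_agree:
  assumes r: "wf r" "trans r" "total r"
    and code: "branch_code r f A e x = branch_code r f A e x'"
    and inj: "inj_on (e x) (branch r f A x)" "inj_on (e x') (branch r f A x')"
    and IH: "\<And>v. (v, w) \<in> r \<Longrightarrow> v \<in> branch r f A x \<union> branch r f A x' \<Longrightarrow>
      v \<in> branch r f A x \<inter> branch r f A x' \<and> e x v = e x' v"
    and w: "w \<in> branch r f A x"
  shows "w \<in> branch r f A x' \<and> e x w = e x' w"
proof -
  let ?B = "branch r f A x" and ?B' = "branch r f A x'"
  note mem = mem_branch_iff[OF r(1)]
  have irrefl: "(v, v) \<notin> r" for v
    using r(1) by auto
  have memD: "v \<in> A" "(v, z) \<in> r" if "v \<in> branch r f A z" for v z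
    using mem[THEN iffD1, OF that] by (rule conjunct1, elim conjE)
  have memF: "f (insert v F) = f (insert z F)"
    if "v \<in> branch r f A z" "finite F" "F \<subseteq> {u \<in> branch r f A z. (u, v) \<in> r}" for v z F
    using mem[THEN iffD1, OF that(1)] that(2,3) by blast
  obtain ws where "set ws \<subseteq> ?B'" "map (e x) [w] = map (e x') ws"
    by (rule branch_code_transfer[OF code, of "[w]"]) (use w in simp, blast)
  then obtain w' where w': "w' \<in> ?B'" "e x w = e x' w'"
    by (auto simp: Cons_eq_map_conv)
  have fwd: "v \<in> ?B' \<and> (v, w') \<in> r" if vw: "v \<in> ?B" "(v, w) \<in> r" for v
  proof -
    have v: "v \<in> ?B'" "e x v = e x' v"
      using IH[OF vw(2)] vw(1) by auto
    obtain ys' where "set ys' \<subseteq> ?B'" "map (e x) [v, w] = map (e x') ys'"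
      "sorted_wrt (\<lambda>y z. (y, z) \<in> r) [v, w] = sorted_wrt (\<lambda>y z. (y, z) \<in> r) ys'"
      by (rule branch_code_transfer[OF code, of "[v, w]"]) (use vw w in simp, blast)
    moreover from this obtain a b where "ys' = [a, b]"
      by (auto simp: Cons_eq_map_conv)
    ultimately have "(a, b) \<in> r" "a = v" "b = w'"
      using v w' vw(2) inj(2) by (auto dest: inj_onD)
    then show ?thesis
      using v by simp
  qed
  \<comment> \<open>The position of \<open>v\<close> relative to \<open>w\<close> is not known yet,
    so \<open>IH\<close> is applied to the partner \<open>a\<close> of \<open>v\<close>, which lies
    below \<open>w\<close>; injectivity then gives \<open>a = v\<close>.\<close>
  have bwd: "v \<in> ?B \<and> (v, w) \<in> r" if vw: "v \<in> ?B'" "(v, w') \<in> r" for v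
  proof -
    obtain ys where ys: "set ys \<subseteq> ?B" "map (e x') [v, w'] = map (e x) ys"
      "sorted_wrt (\<lambda>y z. (y, z) \<in> r) [v, w'] = sorted_wrt (\<lambda>y z. (y, z) \<in> r) ys"
      by (rule branch_code_transfer[OF code[symmetric], of "[v, w']"]) (use vw w' in simp, blast)
    moreover from this obtain a b where ab: "ys = [a, b]"
      by (auto simp: Cons_eq_map_conv)
    ultimately have "b = w" "e x' v = e x a" "a \<in> ?B" "(a, w) \<in> r"
      using w w' vw(2) inj(1) by (auto dest: inj_onD)
    moreover from this have "a \<in> ?B'" "e x a = e x' a"
      using IH[of a] by auto
    ultimately have "a = v"
      using vw(1) inj(2) by (auto dest: inj_onD)
    then show ?thesis
      using \<open>a \<in> ?B\<close> \<open>(a, w) \<in> r\<close> by simp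
  qed
  have col: "f (insert x F) = f (insert x' F)" if "finite F" "F \<subseteq> {z \<in> ?B. (z, w) \<in> r}" for F
    using that fwd IH by (intro branch_code_transfer_eq[OF code inj(2)]) auto
  have "w = w'"
  proof (rule ccontr)
    assume "w \<noteq> w'"
    then consider "(w, w') \<in> r" | "(w', w) \<in> r"
      using r(3) by (auto simp: total_on_def)
    then show False
    proof cases
      case 1
      \<comment> \<open>The colour \<open>f (insert w F)\<close> equals
        \<open>f (insert x F)\<close> because \<open>w\<close> is in the first branch, and this
        equals \<open>f (insert x' F)\<close> by \<open>col\<close>.\<close>
      have "w \<in> ?B'"
        unfolding mem[of w f A x']
      proof (intro conjI allI impI)
        show "w \<in> A"
          using w by (rule memD)
        show "(w, x') \<in> r"
          using r(2) 1 memD(2)[OF w'(1)] by (rule transD)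
        fix F
        assume F: "finite F \<and> F \<subseteq> {z \<in> ?B'. (z, w) \<in> r}"
        have "F \<subseteq> {z \<in> ?B. (z, w) \<in> r}"
          using F bwd 1 r(2) by (auto dest: transD)
        then show "f (insert w F) = f (insert x' F)"
          using F col[of F] memF[OF w, of F] by simp
      qed
      then show False
        using bwd 1 irrefl by blast
    next
      case 2
      have "w' \<in> ?B"
        unfolding mem[of w' f A x]
      proof (intro conjI allI impI)
        show "w' \<in> A"
          using w'(1) by (rule memD)
        show "(w', x) \<in> r"
          using r(2) 2 memD(2)[OF w] by (rule transD)
        fix F
        assume F: "finite F \<and> F \<subseteq> {z \<in> ?B. (z, w') \<in> r}"
        then have F': "F \<subseteq> {z \<in> ?B. (z, w) \<in> r}"
          using 2 r(2) by (auto dest: transD)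
        have "F \<subseteq> {z \<in> ?B'. (z, w') \<in> r}"
          using F F' fwd by auto
        then show "f (insert w' F) = f (insert x F)"
          using F col[of F] F' memF[OF w'(1), of F] by simp
      qed
      then show False
        using fwd 2 irrefl by blast
    qed
  qed
  with w' show ?thesis
    by simp
qed

text \<open>By well-founded induction the two branches are equal with equal labels, so
  \<open>x\<close> and \<open>x'\<close> have the same colours over its finite subsets. If
  \<open>x\<close> came before \<open>x'\<close>, it would belong to the branch of \<open>x'\<close>
  and hence to its own, whose points lie strictly below \<open>x\<close>.\<close>

lemma branch_code_eq_imp_not_less:
  assumes r: "wf r" "trans r" "total r"
    and code: "branch_code r f A e x = branch_code r f A e x'"
    and inj: "inj_on (e x) (branch r f A x)" "inj_on (e x') (branch r f A x')"
    and "x \<in> A"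
  shows "(x, x') \<notin> r"
proof
  assume less: "(x, x') \<in> r"
  have agree: "w \<in> branch r f A x \<union> branch r f A x' \<Longrightarrow>
      w \<in> branch r f A x \<inter> branch r f A x' \<and> e x w = e x' w" for w
    using r(1)
  proof (induction w rule: wf_induct_rule)
    case (less w)
    show ?case
    proof (cases "w \<in> branch r f A x")
      case True
      then show ?thesis
        using branch_code_agree[where e = e, OF r code inj, of w] less.IH by blast
    next
      case False
      then have "w \<in> branch r f A x'"
        using less.prems by blast
      then show ?thesis
        using branch_code_agree[where e = e, OF r code[symmetric] inj(2,1), of w] less.IH
        by (metis IntD1 IntD2 IntI Un_commute)
    qed
  qed
  have "x \<in> branch r f A x'"
    unfolding mem_branch_iff[OF r(1), of x]
  proof (intro conjI allI impI)
    fix F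
    assume F: "finite F \<and> F \<subseteq> {z \<in> branch r f A x'. (z, x) \<in> r}"
    show "f (insert x F) = f (insert x' F)"
      using F agree by (intro branch_code_transfer_eq[OF code inj(2)]) blast+
  qed (use less assms in auto)
  then have "x \<in> branch r f A x"
    using agree by blast
  then show False
    using mem_branch_iff[OF r(1), of x f A x] r(1) by auto
qed

text \<open>Points of \<open>A\<close> are determined by their codes, and each code is a subset of
  one fixed set of size at most \<epsilon>.\<close>

lemma card_of_le_exp_branches:
  fixes \<epsilon> :: "'b rel"
  assumes r: "wf r" "trans r" "total r"
    and \<epsilon>: "Cinfinite \<epsilon>" and K: "|K| \<le>o \<epsilon>" "\<And>F. f F \<in> K"
    and br: "\<And>x. x \<in> A \<Longrightarrow> |branch r f A x| \<le>o \<epsilon>"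
  shows "|A| \<le>o ctwo ^c \<epsilon>"
proof -
  have "\<exists>e. inj_on e (branch r f A x) \<and> e ` branch r f A x \<subseteq> Field \<epsilon>" if "x \<in> A" for x
  proof -
    have "|branch r f A x| \<le>o |Field \<epsilon>|"
      using br[OF that] \<epsilon> card_of_Field_ordIso ordIso_symmetric ordLeq_ordIso_trans by blast
    then show ?thesis
      by (simp add: card_of_ordLeq)
  qed
  then obtain e where e: "\<And>x. x \<in> A \<Longrightarrow> inj_on (e x) (branch r f A x)"
    "\<And>x. x \<in> A \<Longrightarrow> e x ` branch r f A x \<subseteq> Field \<epsilon>"
    by metis
  let ?T = "lists (Field \<epsilon>) \<times> (UNIV :: bool set) \<times> K"
  have "inj_on (branch_code r f A e) A"
  proof (rule inj_onI)
    fix x y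
    assume "x \<in> A" "y \<in> A" "branch_code r f A e x = branch_code r f A e y"
    then have "(x, y) \<notin> r" "(y, x) \<notin> r"
      using branch_code_eq_imp_not_less[OF r, of f A e] e(1) by metis+
    then show "x = y"
      using r(3) by (auto simp: total_on_def)
  qed
  moreover have "branch_code r f A e ` A \<subseteq> Pow ?T"
    using e(2) K(2) by (fastforce simp: branch_code_def)
  ultimately have "|A| \<le>o |Pow ?T|"
    by (rule card_of_ordLeq[THEN iffD1, OF exI, OF conjI])
  also have "|Pow ?T| =o ctwo ^c |?T|"
    unfolding ctwo_def cexp_def Field_card_of by (rule card_of_Pow_Func)
  also have "ctwo ^c |?T| \<le>o ctwo ^c \<epsilon>"
  proof (rule ctwo_cexp_mono)
    have "|UNIV :: bool set| \<le>o \<epsilon>"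
      using \<epsilon> ctwo_ordLeq_Cinfinite by (simp add: ctwo_def)
    moreover have "|lists (Field \<epsilon>)| \<le>o \<epsilon>"
      using \<epsilon> card_of_Field_ordIso ordIso_imp_ordLeq by (intro card_of_lists_le) blast+
    ultimately show "|?T| \<le>o \<epsilon>"
      using \<epsilon> K(1) by (intro card_of_Times_ordLeq_infinite_Field) (auto simp: cinfinite_def)
  qed
  finally show ?thesis .
qed

section \<open>Exponential towers on a fixed type\<close>

lemma ordLeq_imp_ordLeq_exp_tower:
  assumes "Card_order \<mu>" "\<mu> \<le>o \<kappa>"
  shows "ordLeq_exp_tower \<mu> k \<kappa>"
proof (induction k)
  case (Suc k)
  then show ?case
    using assms(1) ordLess_ctwo_cexp[of \<mu>] ordLess_imp_ordLeq by auto
qed (use assms in simp)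

lemma ordLeq_exp_tower_Suc:
  assumes "Card_order \<mu>" "ordLeq_exp_tower \<mu> k \<kappa>"
  shows "ordLeq_exp_tower \<mu> (Suc k) \<kappa>"
  unfolding ordLeq_exp_tower.simps
  using assms ordLess_imp_ordLeq[OF ordLess_ctwo_cexp[OF assms(1)]] by blast

text \<open>If some cardinal on \<open>'b\<close> fails to be below \<epsilon>, then by
  comparability \<epsilon> embeds into it and has an isomorphic copy on \<open>'b\<close>. This
  moves a bound from another type to the type at hand.\<close>

lemma Card_order_internalize:
  fixes \<epsilon> :: "'e rel"
  assumes "Card_order \<epsilon>"
  obtains "\<And>\<mu> :: 'b rel. Card_order \<mu> \<Longrightarrow> \<mu> \<le>o \<epsilon>"
  | \<nu> :: "'b rel" where "Card_order \<nu>" "\<epsilon> =o \<nu>"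
proof (cases "\<forall>\<mu> :: 'b rel. Card_order \<mu> \<longrightarrow> \<mu> \<le>o \<epsilon>")
  case False
  then obtain \<mu> :: "'b rel" where "Card_order \<mu>" "\<not> \<mu> \<le>o \<epsilon>"
    by blast
  then have "\<epsilon> \<le>o \<mu>"
    using assms ordLeq_total by (metis card_order_on_well_order_on)
  then obtain \<nu> :: "'b rel" where "\<epsilon> =o \<nu>"
    by (auto simp: internalize_ordLeq[of \<epsilon> \<mu>])
  then show ?thesis
    using that(2) Card_order_ordIso2[OF assms] by blast
qed (use that in blast)

text \<open>On a single type the tower is either trivial or represented by a cardinal of that type.\<close>

lemma ordLeq_exp_tower_cases:
  fixes \<kappa> :: "'c rel"
  assumes "Card_order \<kappa>"
  obtains "\<And>\<mu> :: 'b rel. Card_order \<mu> \<Longrightarrow> ordLeq_exp_tower \<mu> k \<kappa>"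
  | \<epsilon> :: "'b rel" where "Card_order \<epsilon>"
    "\<And>\<mu> :: 'b rel. Card_order \<mu> \<Longrightarrow> ordLeq_exp_tower \<mu> k \<kappa> \<longleftrightarrow> \<mu> \<le>o \<epsilon>"
proof (induction k arbitrary: thesis)
  case 0
  show ?case
    using assms
  proof (cases rule: Card_order_internalize[where 'b = 'b])
    case 1
    then show ?thesis
      using "0.prems"(1) by simp
  next
    case (2 \<nu>)
    then show ?thesis
      using ordLeq_cong_right[of \<kappa> \<nu>] by (intro "0.prems"(2)[of \<nu>]) simp_all
  qed
next
  case (Suc k)
  show ?case
  proof (rule Suc.IH)
    assume "\<And>\<mu> :: 'b rel. Card_order \<mu> \<Longrightarrow> ordLeq_exp_tower \<mu> k \<kappa>"
    then show ?thesis
      using Suc.prems(1) ordLeq_exp_tower_Suc by blast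
  next
    fix \<epsilon> :: "'b rel"
    assume \<epsilon>: "Card_order \<epsilon>"
      "\<And>\<mu> :: 'b rel. Card_order \<mu> \<Longrightarrow> ordLeq_exp_tower \<mu> k \<kappa> \<longleftrightarrow> \<mu> \<le>o \<epsilon>"
    have iff: "ordLeq_exp_tower \<mu> (Suc k) \<kappa> \<longleftrightarrow> \<mu> \<le>o ctwo ^c \<epsilon>" if "Card_order \<mu>" for \<mu> :: "'b rel"
      using \<epsilon>(2,1) that by (rule ordLeq_exp_tower_Suc_iff)
    \<comment> \<open>\<open>ctwo ^c \<epsilon>\<close> lives on a function type, so it has to be
      brought back to \<open>'b\<close>.\<close>
    have "Card_order (ctwo ^c \<epsilon>)"
      by (rule Card_order_cexp)
    then show ?thesis
    proof (cases rule: Card_order_internalize[where 'b = 'b])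
      case 1
      then show ?thesis
        using Suc.prems(1) iff by blast
    next
      case (2 \<nu>)
      then show ?thesis
        using Suc.prems(2)[of \<nu>] iff ordLeq_cong_right by blast
    qed
  qed
qed

section \<open>Homogeneous sets and the induction on the exponent\<close>

lemma exists_strict_well_order:
  obtains r :: "'a rel" where "wf r" "trans r" "total r"
proof -
  obtain R :: "'a rel" where R: "Well_order R" "Field R = UNIV"
    using Zorn.well_ordering by metis
  then have "wf (R - Id)" "trans R" "antisym R" "total R"
    by (simp_all add: well_order_on_def linear_order_on_def partial_order_on_def preorder_on_def)
  then show ?thesis
    using that[of "R - Id"] by (simp add: trans_diff_Id total_on_diff_Id)
qed

definition homogeneous_set :: "nat \<Rightarrow> ('a set \<Rightarrow> 'k) \<Rightarrow> 'a set \<Rightarrow> bool" where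
  "homogeneous_set m f H \<longleftrightarrow> (\<exists>k. \<forall>F \<subseteq> H. finite F \<and> card F = m \<longrightarrow> f F = k)"

text \<open>Branches are end-homogeneous: in a finite \<open>G\<close> inside the branch, the
  largest element \<open>m\<close> can be replaced by \<open>x\<close> without changing the colour,
  because the rest of \<open>G\<close> lies below \<open>m\<close>.\<close>

lemma homogeneous_set_branch:
  assumes r: "wf r" "trans r" "total r"
    and Y: "Y \<subseteq> branch r f A x" "homogeneous_set (Suc n) (\<lambda>F. f (insert x F)) Y"
  shows "homogeneous_set (Suc (Suc n)) f Y"
proof -
  obtain k where k: "\<And>F. F \<subseteq> Y \<Longrightarrow> finite F \<Longrightarrow> card F = Suc n \<Longrightarrow> f (insert x F) = k"
    using Y(2) by (auto simp: homogeneous_set_def)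
  have "f G = k" if G: "G \<subseteq> Y" "finite G" "card G = Suc (Suc n)" for G
  proof -
    have "\<exists>m\<in>G. \<forall>y\<in>G. y \<noteq> m \<longrightarrow> \<not> (m, y) \<in> r"
      using G r(1,2) by (intro Finite_Set.bex_max_element)
        (auto intro!: transp_onI asymp_onI dest: transD wf_asym)
    then obtain m where m: "m \<in> G" "\<And>y. y \<in> G - {m} \<Longrightarrow> (y, m) \<in> r"
      using r(3) by (auto simp: total_on_def)
    have "f (insert m (G - {m})) = f (insert x (G - {m}))"
      using mem_branch_iff[OF r(1), of m f A x] m G Y(1) by blast
    moreover have "f (insert x (G - {m})) = k"
      using G m(1) by (intro k) auto
    ultimately show ?thesis
      using m(1) by (simp add: insert_absorb)
  qed
  then show ?thesis
    by (auto simp: homogeneous_set_def)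
qed

text \<open>Induction on \<open>n\<close> over all \<open>A\<close> and \<open>f\<close>. For
  \<open>n = 0\<close> the colour classes of points are homogeneous and there are at most \<kappa>
  of them. In the step, the colouring \<open>f (insert x F)\<close> on the branch of
  \<open>x\<close> satisfies the hypothesis, so every branch is below stage \<open>n\<close> of the
  tower; counting codes adds one exponential.\<close>

theorem erdos_rado:
  fixes \<kappa> :: "'c rel" and A :: "'a set"
  assumes "Cinfinite \<kappa>" "|K| \<le>o \<kappa>" "\<And>F. f F \<in> K"
    and "\<And>H. H \<subseteq> A \<Longrightarrow> homogeneous_set (Suc n) f H \<Longrightarrow> |H| \<le>o \<kappa>"
  shows "ordLeq_exp_tower |A| n \<kappa>"
  using assms(3,4)
proof (induction n arbitrary: A f)
  case 0
  have "|{a \<in> A. f {a} = k}| \<le>o \<kappa>" for k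
    by (rule "0.prems"(2)) (auto simp: homogeneous_set_def card_Suc_eq)
  then have "|\<Union>k\<in>K. {a \<in> A. f {a} = k}| \<le>o \<kappa>"
    using assms(1,2) by (intro UNION_Cinfinite_bound) auto
  moreover have "(\<Union>k\<in>K. {a \<in> A. f {a} = k}) = A"
    using "0.prems"(1) by auto
  ultimately show ?case
    by simp
next
  case (Suc n)
  obtain r :: "'a rel" where r: "wf r" "trans r" "total r"
    by (rule exists_strict_well_order)
  have br: "ordLeq_exp_tower |branch r f A x| n \<kappa>" for x
  proof (rule Suc.IH)
    fix Y
    assume "Y \<subseteq> branch r f A x" "homogeneous_set (Suc n) (\<lambda>F. f (insert x F)) Y"
    moreover from this have "Y \<subseteq> A"
      using mem_branch_iff[OF r(1), of _ f A x] by blast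
    ultimately show "|Y| \<le>o \<kappa>"
      using homogeneous_set_branch[OF r] Suc.prems(2) by blast
  qed (rule Suc.prems(1))
  have \<kappa>: "Card_order \<kappa>"
    using assms(1) by simp
  show ?case
    using \<kappa>
  proof (cases rule: Card_order_internalize[where 'b = 'a])
    case 1
    then show ?thesis
      using ordLeq_imp_ordLeq_exp_tower card_of_Card_order by blast
  next
    case (2 \<nu>)
    show ?thesis
      using \<kappa>
    proof (cases rule: ordLeq_exp_tower_cases[where 'b = 'a and k = n])
      case 1
      then show ?thesis
        using ordLeq_exp_tower_Suc card_of_Card_order by blast
    next
      case (2 \<epsilon>)
      \<comment> \<open>Towers grow, so the copy \<nu> of \<kappa> is below stage \<open>n\<close>,
        which \<epsilon> represents for cardinals on \<open>'a\<close>. Hence \<epsilon> is infinite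
        and bounds the number of colours.\<close>
      have "ordLeq_exp_tower \<nu> n \<kappa>"
        using \<open>Card_order \<nu>\<close> \<open>\<kappa> =o \<nu>\<close> ordIso_imp_ordLeq[OF ordIso_symmetric]
        by (intro ordLeq_imp_ordLeq_exp_tower) auto
      then have "\<kappa> \<le>o \<epsilon>"
        using 2(2) \<open>Card_order \<nu>\<close> \<open>\<kappa> =o \<nu>\<close> ordIso_ordLeq_trans by blast
      then have "Cinfinite \<epsilon>" "|K| \<le>o \<epsilon>"
        using assms(1,2) 2(1) cinfinite_mono ordLeq_transitive by blast+
      then have "|A| \<le>o ctwo ^c \<epsilon>"
      proof (rule card_of_le_exp_branches[OF r])
        show "|branch r f A x| \<le>o \<epsilon>" for x
          using br[of x] 2(2)[OF card_of_Card_order] by simp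
      qed (rule Suc.prems(1))
      moreover have "ordLeq_exp_tower \<epsilon> n \<kappa>"
        using 2 by (simp add: ordLeq_refl)
      ultimately show ?thesis
        using 2(1) by auto
    qed
  qed
qed


section \<open>Families of open sets\<close>

lemma finite_ordLeq_Cinfinite:
  assumes "finite F" "Cinfinite \<kappa>"
  shows "|F| \<le>o \<kappa>"
proof -
  have "Cfinite |F|"
    using assms(1) card_of_Card_order by (simp add: cfinite_def Field_card_of)
  then show ?thesis
    using assms(2) by (intro ordLess_imp_ordLeq Cfinite_ordLess_Cinfinite)
qed

text \<open>The finite index sets in \<open>M\<close> cover \<open>I\<close>, and their
  intersections are distinct and form a cellular family, so their union has size at most \<kappa>.
  Indices are counted rather than sets, so repeated values of \<open>V\<close> do no harm.\<close>

lemma card_of_open_family_le: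
  fixes \<kappa> :: "'c rel" and V :: "'i \<Rightarrow> 'a set"
  assumes \<kappa>: "Cinfinite \<kappa>"
    and cell: "\<And>\<F>. cellular_family X \<F> \<Longrightarrow> |\<F>| \<le>o \<kappa>"
    and V: "\<And>i. i \<in> I \<Longrightarrow> openin X (V i) \<and> V i \<noteq> {}"
    and n: "\<And>F. F \<subseteq> I \<Longrightarrow> finite F \<Longrightarrow> card F = n \<Longrightarrow> (\<Inter>i\<in>F. V i) = {}"
  shows "|I| \<le>o \<kappa>"
proof -
  define N where "N = {F. F \<subseteq> I \<and> finite F \<and> F \<noteq> {} \<and> (\<Inter>i\<in>F. V i) \<noteq> {}}"
  define M where "M = {F \<in> N. \<forall>G\<in>N. F \<subseteq> G \<longrightarrow> G = F}"
  have card: "card F \<le> n" if "F \<in> N" for F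
  proof (rule ccontr)
    assume "\<not> card F \<le> n"
    then obtain G where "G \<subseteq> F" "card G = n"
      by (metis linorder_le_cases obtain_subset_with_card_n)
    moreover from this have "(\<Inter>i\<in>F. V i) \<subseteq> (\<Inter>i\<in>G. V i)" "finite G" "G \<subseteq> I"
      using that by (auto simp: N_def intro: finite_subset)
    ultimately show False
      using n[of G] that by (auto simp: N_def)
  qed
  have cover: "\<exists>F\<in>M. i \<in> F" if "i \<in> I" for i
  proof -
    have i: "{i} \<in> N"
      using V that by (auto simp: N_def)
    \<comment> \<open>Sizes in \<open>N\<close> are at most \<open>n\<close>, so a member of largest
      size containing \<open>i\<close> exists; it is then also maximal under inclusion.\<close>
    define F where "F = (ARG_MAX card F. F \<in> N \<and> i \<in> F)"
    have F: "F \<in> N" "i \<in> F" "\<And>G. G \<in> N \<Longrightarrow> i \<in> G \<Longrightarrow> card G \<le> card F"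
      using arg_max_nat_lemma[of "\<lambda>F. F \<in> N \<and> i \<in> F" "{i}" card "Suc n"] i card
      by (auto simp: F_def less_Suc_eq_le)
    have "G = F" if "G \<in> N" "F \<subseteq> G" for G
      using that F card_seteq[of G F] by (auto simp: N_def)
    then show ?thesis
      using F by (auto simp: M_def)
  qed
  have eq: "F = G" if FG: "F \<in> M" "G \<in> M" "(\<Inter>i\<in>F. V i) \<inter> (\<Inter>i\<in>G. V i) \<noteq> {}" for F G
  proof -
    \<comment> \<open>The intersection over the union is the intersection of the two, which is
      nonempty; maximality makes both equal to the union.\<close>
    have "F \<union> G \<in> N"
      using FG unfolding M_def N_def by (simp add: INT_Un)
    then have "F \<union> G = F" "F \<union> G = G"
      using FG(1,2) unfolding M_def by simp_all
    then show ?thesis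
      by simp
  qed
  let ?W = "\<lambda>F. \<Inter>i\<in>F. V i"
  have inj: "inj_on ?W M"
  proof (rule inj_onI)
    fix F G
    assume FG: "F \<in> M" "G \<in> M" "?W F = ?W G"
    moreover have "?W F \<noteq> {}"
      using FG(1) unfolding M_def N_def by blast
    ultimately show "F = G"
      using eq[of F G] by simp
  qed
  have "cellular_family X (?W ` M)"
    unfolding cellular_family_def pairwise_def disjnt_def
  proof (intro conjI ballI impI)
    fix U
    assume "U \<in> ?W ` M"
    then obtain F where F: "F \<in> N" "U = ?W F"
      unfolding M_def by blast
    then show "U \<noteq> {}"
      unfolding N_def by blast
    have "openin X (V i)" if "i \<in> F" for i
      using F(1) V that unfolding N_def by blast
    then show "openin X U"
      using F unfolding F(2) N_def by (intro openin_INT2) blast+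
  next
    fix U U'
    assume "U \<in> ?W ` M" "U' \<in> ?W ` M" "U \<noteq> U'"
    then obtain F G where FG: "F \<in> M" "G \<in> M" "U = ?W F" "U' = ?W G" "F \<noteq> G"
      by blast
    show "U \<inter> U' = {}"
      using eq[OF FG(1,2)] FG(5) unfolding FG(3,4) by argo
  qed
  then have "|?W ` M| \<le>o \<kappa>"
    by (rule cell)
  then have "|M| \<le>o \<kappa>"
    by (rule ordIso_ordLeq_trans[OF card_of_ordIsoI[OF inj_on_imp_bij_betw[OF inj]]])
  moreover have "|F| \<le>o \<kappa>" if "F \<in> M" for F
    using that \<kappa> unfolding M_def N_def by (intro finite_ordLeq_Cinfinite) blast+
  ultimately have "|\<Union>F\<in>M. F| \<le>o \<kappa>"
    using \<kappa> by (intro UNION_Cinfinite_bound ballI)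
  moreover have "|I| \<le>o |\<Union>F\<in>M. F|"
    using cover by (intro card_of_mono1) auto
  ultimately show ?thesis
    by (rule ordLeq_transitive[rotated])
qed


section \<open>Cardinal functions\<close>

lemma is_least_cardinal_cellularity:
  fixes X :: "'a topology"
  shows "is_least_cardinal (\<lambda>\<kappa>. \<forall>\<F>. cellular_family X \<F> \<longrightarrow> |\<F>| \<le>o \<kappa>)
    (least_cardinal (\<lambda>\<kappa> :: 'a set rel. \<forall>\<F>. cellular_family X \<F> \<longrightarrow> |\<F>| \<le>o \<kappa>))"
  by (rule is_least_cardinal_least_cardinal) (rule card_of_Card_order, rule cellularity_exists)

lemma is_least_cardinal_pi_character:
  fixes X :: "'a topology"
  shows "is_least_cardinal (\<lambda>\<kappa>. \<forall>x\<in>topspace X. pi_character_at X x \<le>o \<kappa>)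
    (least_cardinal (\<lambda>\<kappa> :: 'a set rel. \<forall>x\<in>topspace X. pi_character_at X x \<le>o \<kappa>))"
  by (rule is_least_cardinal_least_cardinal) (rule card_of_Card_order, rule pi_character_exists)

lemma Cnotzero_if_nonempty_ordLeq:
  assumes "|S| \<le>o \<mu>" "S \<noteq> {}" "Card_order \<mu>"
  shows "Cnotzero \<mu>"
  using assms by (metis czeroI card_of_empty3 card_of_ordIso_czero_iff_empty ordLeq_ordIso_trans
      card_of_empty2 ordIso_symmetric ordLeq_transitive ordIso_imp_ordLeq)

lemma natLeq_cprod:
  assumes "Cnotzero \<mu>"
  shows "Cinfinite (natLeq *c \<mu>)" "\<mu> \<le>o natLeq *c \<mu>"
proof -
  have "Cinfinite (\<mu> *c natLeq)"
    using assms natLeq_Cinfinite by (rule Cinfinite_cprod2)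
  then show "Cinfinite (natLeq *c \<mu>)"
    using cprod_com Cinfinite_cong by blast
  show "\<mu> \<le>o natLeq *c \<mu>"
    using assms natLeq_Cinfinite Cinfinite_Cnotzero by (intro ordLeq_cprod2) auto
qed

lemma cellularity:
  fixes X :: "'a topology"
  assumes "topspace X \<noteq> {}"
  shows "Cinfinite (cellularity X)" "cellular_family X \<F> \<Longrightarrow> |\<F>| \<le>o cellularity X"
proof -
  let ?\<mu> = "least_cardinal (\<lambda>\<kappa> :: 'a set rel. \<forall>\<F>. cellular_family X \<F> \<longrightarrow> |\<F>| \<le>o \<kappa>)"
  have \<mu>: "Card_order ?\<mu>" "\<And>\<F>. cellular_family X \<F> \<Longrightarrow> |\<F>| \<le>o ?\<mu>"
    using is_least_cardinal_cellularity[of X] by (auto simp: is_least_cardinal_def)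
  \<comment> \<open>This one-member family makes the supremum nonzero, so that the factor
    \<open>natLeq\<close> makes the product infinite.\<close>
  have "cellular_family X {topspace X}"
    using assms by (simp add: cellular_family_def)
  then have "Cnotzero ?\<mu>"
    using \<mu> Cnotzero_if_nonempty_ordLeq by blast
  then show "Cinfinite (cellularity X)" "cellular_family X \<F> \<Longrightarrow> |\<F>| \<le>o cellularity X"
    unfolding cellularity_def using natLeq_cprod[of ?\<mu>] \<mu>(2) ordLeq_transitive by blast+
qed

lemma pi_character:
  fixes X :: "'a topology"
  assumes "p \<in> topspace X"
  obtains \<B> where "local_pi_base X p \<B>" "|\<B>| \<le>o pi_character X"
    and "Cinfinite (pi_character X)" "\<B> \<noteq> {}"
proof -
  let ?\<mu> = "least_cardinal (\<lambda>\<kappa> :: 'a set rel. \<forall>x\<in>topspace X. pi_character_at X x \<le>o \<kappa>)"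
  have \<mu>: "Card_order ?\<mu>" "pi_character_at X p \<le>o ?\<mu>"
    using is_least_cardinal_pi_character[of X] assms by (auto simp: is_least_cardinal_def)
  have "is_least_cardinal (\<lambda>\<kappa>. \<exists>\<B>. local_pi_base X p \<B> \<and> \<kappa> =o |\<B>| ) (pi_character_at X p)"
    unfolding pi_character_at_def
    by (rule is_least_cardinal_least_cardinal)
      (rule card_of_Card_order, rule pi_character_at_exists)
  then obtain \<B> where \<B>: "local_pi_base X p \<B>" "pi_character_at X p =o |\<B>|"
    by (auto simp: is_least_cardinal_def)
  then have le: "|\<B>| \<le>o ?\<mu>"
    using \<mu>(2) ordIso_symmetric ordIso_ordLeq_trans by blast
  \<comment> \<open>The whole space is a neighbourhood of \<open>p\<close> and so contains a member
    of \<open>\<B>\<close>; hence the supremum is nonzero and its product with \<open>natLeq\<close>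
    infinite.\<close>
  have ne: "\<B> \<noteq> {}"
    using \<B>(1) assms unfolding local_pi_base_def by (metis equals0D openin_topspace)
  show ?thesis
    using that[OF \<B>(1)] natLeq_cprod[of ?\<mu>] Cnotzero_if_nonempty_ordLeq[OF le ne \<mu>(1)] le ne ordLeq_transitive
    unfolding pi_character_def by blast
qed

text \<open>The least cardinal satisfies \<open>hausdorff_bound\<close> itself, and it is at most
  \<open>n\<close>, the size of \<open>A\<close>; so the bound applies to \<open>A\<close>.\<close>

lemma n_hausdorffD:
  assumes "n_hausdorff n X" "A \<subseteq> topspace X" "finite A" "card A = n"
  obtains U where "\<And>a. a \<in> A \<Longrightarrow> openin X (U a) \<and> a \<in> U a" "topspace X \<inter> (\<Inter>a\<in>A. U a) = {}"
proof -
  have "is_least_cardinal (hausdorff_bound X) (hausdorff_number X)"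
    unfolding hausdorff_number_def
    by (rule is_least_cardinal_least_cardinal)
      (rule card_of_Card_order, rule hausdorff_number_exists)
  moreover obtain g where "bij_betw g {..<n} A"
    using ex_bij_betw_nat_finite[OF assms(3)] assms(4) by (auto simp: lessThan_atLeast0)
  then have "|{..<n}| =o |A|"
    by (rule card_of_ordIsoI)
  then have "hausdorff_number X \<le>o |A|"
    using assms(1) unfolding n_hausdorff_def using ordLeq_ordIso_trans by blast
  ultimately have "\<exists>U. (\<forall>a\<in>A. openin X (U a) \<and> a \<in> U a) \<and> topspace X \<inter> (\<Inter>a\<in>A. U a) = {}"
    using assms(2) unfolding is_least_cardinal_def hausdorff_bound_def by simp
  then show ?thesis
    using that by blast
qed

section \<open>Colouring of n-element sets by members of a local pi-base\<close>

theorem theorem3p6: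
  fixes n :: nat and X :: "'a topology"
  assumes "n \<ge> 2"
    and "n_hausdorff n X"
    and "homogeneous_space X"
  shows "ordLeq_exp_tower |topspace X| (n - 1) (cellularity X *c pi_character X)"
proof (cases "topspace X = {}")
  \<comment> \<open>In the empty space both cardinal functions are zero rather than infinite, hence
    the separate case.\<close>
  case True
  then show ?thesis
    by (simp add: ordLeq_imp_ordLeq_exp_tower card_of_Card_order Card_order_empty Card_order_cprod)
next
  case False
  then obtain p where p: "p \<in> topspace X"
    by blast
  let ?\<kappa> = "cellularity X *c pi_character X"
  obtain \<B> where \<B>: "local_pi_base X p \<B>" "|\<B>| \<le>o pi_character X" "Cinfinite (pi_character X)" "\<B> \<noteq> {}"
    using pi_character[OF p] by blast
  note cell = cellularity[OF False]
  have "cellularity X \<le>o pi_character X *c cellularity X"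
    by (rule ordLeq_cprod2) (use \<B>(3) cell(1) Cinfinite_Cnotzero in blast)+
  then have c_le: "cellularity X \<le>o ?\<kappa>"
    using cprod_com by (rule ordLeq_ordIso_trans)
  have pi_le: "pi_character X \<le>o ?\<kappa>"
    by (rule ordLeq_cprod2) (use \<B>(3) cell(1) Cinfinite_Cnotzero in blast)+
  have \<kappa>: "Cinfinite ?\<kappa>"
    by (rule Cinfinite_cprod2[OF Cinfinite_Cnotzero[OF cell(1)] \<B>(3)])
  have card_\<B>: "|\<B>| \<le>o ?\<kappa>"
    by (rule ordLeq_transitive[OF \<B>(2) pi_le])
  have cell_le: "|\<F>| \<le>o ?\<kappa>" if "cellular_family X \<F>" for \<F>
    by (rule ordLeq_transitive[OF cell(2)[OF that] c_le])
  obtain h where h: "\<And>x. x \<in> topspace X \<Longrightarrow> homeomorphic_map X X (h x) \<and> h x p = x"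
    using assms(3) p unfolding homogeneous_space_def by metis
  have ex: "\<exists>B\<in>\<B>. (\<Inter>a\<in>F. h a ` B) = {}" if F: "F \<subseteq> topspace X" "finite F" "card F = n" for F
  proof -
    obtain U where U: "\<And>a. a \<in> F \<Longrightarrow> openin X (U a) \<and> a \<in> U a" "topspace X \<inter> (\<Inter>a\<in>F. U a) = {}"
      using n_hausdorffD[OF assms(2) F] by blast
    have ne: "F \<noteq> {}"
      using F assms(1) by auto
    \<comment> \<open>Since \<open>h a p = a\<close>, each of these preimages is a neighbourhood of
      \<open>p\<close>. As \<open>n \<ge> 2\<close>, the set \<open>F\<close> is nonempty, so this
      is a finite nonempty intersection of open sets.\<close>
    let ?W = "\<Inter>a\<in>F. {z \<in> topspace X. h a z \<in> U a}"
    have "openin X ?W"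
      using F U(1) h ne homeomorphic_imp_continuous_map
      by (intro openin_INT2 openin_continuous_map_preimage[of X X]) blast+
    moreover have "p \<in> ?W"
      using p F(1) U(1) h by auto
    ultimately obtain B where B: "B \<in> \<B>" "B \<subseteq> ?W"
      using \<B>(1) unfolding local_pi_base_def by meson
    have "(\<Inter>a\<in>F. h a ` B) \<subseteq> topspace X \<inter> (\<Inter>a\<in>F. U a)"
    proof (rule subsetI)
      fix z
      assume "z \<in> (\<Inter>a\<in>F. h a ` B)"
      then have "z \<in> h a ` B" if "a \<in> F" for a
        using that by simp
      then have z: "z \<in> U a" if "a \<in> F" for a
        using that B(2) by blast
      obtain a where "a \<in> F"
        using ne by blast
      then have "z \<in> topspace X"
        using z U(1) openin_subset by blast
      then show "z \<in> topspace X \<inter> (\<Inter>a\<in>F. U a)"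
        using z by blast
    qed
    then show ?thesis
      unfolding U(2) subset_empty using B(1) by (rule bexI)
  qed
  \<comment> \<open>On sets other than n-element subsets of the space the colour is an arbitrary
    member of \<open>\<B>\<close>, so that all colours lie in \<open>\<B>\<close>.\<close>
  define f where "f F = (SOME B. B \<in> \<B> \<and>
    (F \<subseteq> topspace X \<and> finite F \<and> card F = n \<longrightarrow> (\<Inter>a\<in>F. h a ` B) = {}))" for F
  have "\<exists>B. B \<in> \<B> \<and> (F \<subseteq> topspace X \<and> finite F \<and> card F = n \<longrightarrow> (\<Inter>a\<in>F. h a ` B) = {})" for F
    using ex \<B>(4) by blast
  then have f: "f F \<in> \<B> \<and>
      (F \<subseteq> topspace X \<and> finite F \<and> card F = n \<longrightarrow> (\<Inter>a\<in>F. h a ` f F) = {})" for F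
    unfolding f_def by (rule someI_ex)
  show ?thesis
  \<comment> \<open>Here \<open>Suc (n - 1)\<close> is \<open>n\<close> because
    \<open>n \<ge> 2\<close>, and colouring n-element sets costs \<open>n - 1\<close>
    exponentials.\<close>
  proof (rule erdos_rado[OF \<kappa> card_\<B>])
    show "f F \<in> \<B>" for F
      using f by blast
    fix H
    assume H: "H \<subseteq> topspace X" "homogeneous_set (Suc (n - 1)) f H"
    then obtain B where B: "\<And>F. F \<subseteq> H \<Longrightarrow> finite F \<Longrightarrow> card F = n \<Longrightarrow> f F = B"
      using assms(1) by (auto simp: homogeneous_set_def)
    show "|H| \<le>o ?\<kappa>"
    \<comment> \<open>Only an n-element subset of \<open>H\<close> forces \<open>B\<close> to be a
      value of \<open>f\<close> and thus a member of \<open>\<B>\<close>. Without such a subset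
      \<open>H\<close> is finite.\<close>
    proof (cases "\<exists>F \<subseteq> H. finite F \<and> card F = n")
      case True
      then have "B \<in> \<B>"
        using B f by metis
      then have "openin X B" "B \<noteq> {}"
        using \<B>(1) by (auto simp: local_pi_base_def)
      then have "openin X (h a ` B) \<and> h a ` B \<noteq> {}" if "a \<in> H" for a
        using homeomorphic_imp_open_map[of X X "h a"] that H(1) h unfolding open_map_def by blast
      moreover have "(\<Inter>a\<in>F. h a ` B) = {}" if "F \<subseteq> H" "finite F" "card F = n" for F
        using that B f[of F] H(1) by auto
      ultimately show ?thesis
        by (intro card_of_open_family_le[OF \<kappa> cell_le])
    next
      case False
      then have "finite H"
        by (metis infinite_arbitrarily_large)
      then show ?thesis
        using \<kappa> by (rule finite_ordLeq_Cinfinite)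
    qed
  qed
qed

end
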